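(* Let $L$ be a unique factorization domain containing a field of characteristic $0$, let $x\in L\setminus\mathbb{Z}_{<0}$ be such that $x+k$ is invertible in $L$ for every positive integer $k$, let $r,m$ be positive integers, and let $\alpha_1,\ldots,\alpha_m\in L\setminus\{0\}$ be pairwise distinct. For a positive integer $n$ and an integer $0\le l\le rm$ define $$P_{n,l}(z)=S_{n,x}^{(r)}\Big(T^l\prod_{i=1}^m(T-\alpha_i)^{rn}\Big)\Big|_{T=z},\qquad P_{n,l,i,s}(z)=\varphi_{\alpha_i,x,s}\left(\frac{P_{n,l}(z)-P_{n,l}(T)}{z-T}\right)$$ for $1\le i\le m$, $1\le s\le r$, where $\varphi_{\alpha_i,x,s}$ acts on the variable $T$. Then for each $0\le l\le rm$, the family $(P_{n,l}(z),P_{n,l,i,s}(z))_{1\le i\le m,1\le s\le r}$ is a Padé type approximant of $(\Phi_s(x,\alpha_i/z))_{1\le i\le m,1\le s\le r}$ of weight $(n,\ldots,n)\in\mathbb{N}^{rm}$ and of degree $rmn+l$.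
   Context: ${\rm ord}_\infty$ on $L[z][[1/z]]$ is ${\rm ord}_\infty(\sum_k a_k z^{-k})=\min\{k: a_k\ne0\}$. For $f_1,\ldots,f_N\in\frac1z L[[1/z]]$, $\mathbf{n}=(n_1,\ldots,n_N)\in\mathbb{N}^N$ and $M\ge 1$, a Padé type approximant of $(f_1,\ldots,f_N)$ of weight $\mathbf n$ and degree $M$ is a family $(P_0,P_1,\ldots,P_N)\in L[z]^{N+1}$ with $\deg P_0\le M$ and ${\rm ord}_\infty(P_0f_j-P_j)\ge n_j+1$ for $1\le j\le N$. Here $\Phi_s(x,\alpha/z)$ denotes the formal series $\sum_{k\ge0}\frac{\alpha^{k+1}}{(k+x+1)^s}z^{-(k+1)}$. The $L$-linear maps on $L[T]$: ${\rm Prim}_x(T^k)=\frac{T^k}{k+x+1}$, with inverse ${\rm Deri}_x(T^k)=(k+x+1)T^k$; $S_{n,x}(T^k)=\frac{(k+x+1)_n}{n!}T^k$ with $(a)_n=a(a+1)\cdots(a+n-1)$; for a map $\psi$, $\psi^{(r)}$ is its $r$-fold composition. For $\alpha\in L$ and $s\in\mathbb{Z}$, $\varphi_{\alpha,x,s}:L[T]\to L$ is $P\mapsto \alpha\cdot({\rm Prim}_x^{(s)}P)(\alpha)$ (with ${\rm Prim}_x^{(s)}={\rm Deri}_x^{(-s)}$ for $s<0$); thus $\varphi_{\alpha,x,s}(T^k)=\frac{\alpha^{k+1}}{(k+x+1)^s}$. *)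

theory Defs
  imports
    "HOL-Computational_Algebra.Computational_Algebra"
    "HOL-Library.Extended"
begin

text \<open>
  A subset of a ring that is a field for the operations of the ring. Its characteristic is
  that of the ring, because both have the same unit element.
\<close>

definition char_0_subfield :: "'a::comm_ring_1 set \<Rightarrow> bool" where
  "char_0_subfield K \<longleftrightarrow>
     0 \<in> K \<and> 1 \<in> K \<and>
     (\<forall>a\<in>K. \<forall>b\<in>K. a + b \<in> K \<and> a * b \<in> K) \<and>
     (\<forall>a\<in>K. - a \<in> K) \<and>
     (\<forall>a\<in>K. a \<noteq> 0 \<longrightarrow> (\<exists>b\<in>K. a * b = 1)) \<and>
     CHAR('a) = 0"


subsection \<open>Series in $1/z$ and Pade type approximants\<close>

text \<open>
  The ring $L[z][[1/z]]$ is the library's ring of formal Laurent series, whose variable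
  \<open>fls_X\<close> stands for $1/z$; hence \<open>fls_X_inv\<close> stands for $z$, and the
  order at infinity is the subdegree, except that the order of \<open>0\<close> is infinite.
\<close>

definition ord_infty :: "'a::zero fls \<Rightarrow> int extended" where
  "ord_infty f = (if f = 0 then Pinf else Fin (fls_subdegree f))"

definition poly_in_z :: "'a::comm_ring_1 poly \<Rightarrow> 'a fls" where
  "poly_in_z P = poly (map_poly fls_const P) fls_X_inv"

definition inv_z_series :: "'a::comm_ring_1 fls set" where
  "inv_z_series = range (\<lambda>g. fls_X * fps_to_fls g)"

text \<open>
  The series and the weights are indexed by a finite set \<open>J\<close>, which plays the role of
  \<open>{1..N}\<close>.
\<close>

definition pade_type_approximant ::
    "'j set \<Rightarrow> ('j \<Rightarrow> 'a::comm_ring_1 fls) \<Rightarrow> ('j \<Rightarrow> nat) \<Rightarrow> nat \<Rightarrow> 'a poly \<Rightarrow> ('j \<Rightarrow> 'a poly) \<Rightarrow> bool"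
  where
  "pade_type_approximant J f n M P0 P \<longleftrightarrow>
     finite J \<and> (\<forall>j\<in>J. f j \<in> inv_z_series) \<and> M \<ge> 1 \<and>
     degree P0 \<le> M \<and>
     (\<forall>j\<in>J. ord_infty (poly_in_z P0 * f j - poly_in_z (P j)) \<ge> Fin (int (n j) + 1))"

definition Phi :: "nat \<Rightarrow> 'a::idom_divide \<Rightarrow> 'a \<Rightarrow> 'a fls" where
  "Phi s x \<alpha> =
     fls_X * fps_to_fls (Abs_fps (\<lambda>k. \<alpha> ^ (k + 1) div (of_nat k + x + 1) ^ s))"


subsection \<open>Linear maps on polynomials\<close>

text \<open>
  The linear map that sends $T^k$ to \<open>b k\<close>. Divisions by units are written with the exact
  division \<open>div\<close> of the ring.
\<close>

definition linear_ext :: "(nat \<Rightarrow> 'a poly) \<Rightarrow> 'a::comm_ring_1 poly \<Rightarrow> 'a poly" where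
  "linear_ext b P = (\<Sum>k\<le>degree P. smult (coeff P k) (b k))"

definition Prim :: "'a::idom_divide \<Rightarrow> 'a poly \<Rightarrow> 'a poly" where
  "Prim x = linear_ext (\<lambda>k. monom (1 div (of_nat k + x + 1)) k)"

definition Deri :: "'a::idom_divide \<Rightarrow> 'a poly \<Rightarrow> 'a poly" where
  "Deri x = linear_ext (\<lambda>k. monom (of_nat k + x + 1) k)"

definition Prim_iter :: "int \<Rightarrow> 'a::idom_divide \<Rightarrow> 'a poly \<Rightarrow> 'a poly" where
  "Prim_iter s x = (if s \<ge> 0 then Prim x ^^ nat s else Deri x ^^ nat (- s))"

definition S_op :: "nat \<Rightarrow> 'a::idom_divide \<Rightarrow> 'a poly \<Rightarrow> 'a poly" where
  "S_op n x =
     linear_ext (\<lambda>k. monom (pochhammer (of_nat k + x + 1) n div of_nat (fact n)) k)"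

definition phi :: "'a::idom_divide \<Rightarrow> 'a \<Rightarrow> int \<Rightarrow> 'a poly \<Rightarrow> 'a" where
  "phi \<alpha> x s P = \<alpha> * poly (Prim_iter s x P) \<alpha>"

text \<open>
  Elements of $L[z][T]$ are polynomials in $T$ with coefficients in $L[z]$, of type
  \<open>'a poly poly\<close>; \<open>phi_T\<close> is the $L[z]$-linear extension of \<open>phi\<close> to $L[z][T]$, and
  \<open>divided_difference P\<close> is $(P(z) - P(T)) / (z - T)$.
\<close>

definition phi_T :: "'a::idom_divide \<Rightarrow> 'a \<Rightarrow> int \<Rightarrow> 'a poly poly \<Rightarrow> 'a poly" where
  "phi_T \<alpha> x s Q = (\<Sum>k\<le>degree Q. smult (phi \<alpha> x s (monom 1 k)) (coeff Q k))"

definition divided_difference :: "'a::idom_divide poly \<Rightarrow> 'a poly poly" where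
  "divided_difference P = ([:P:] - map_poly (\<lambda>c. [:c:]) P) div [:[:0, 1:], [:- 1:]:]"


subsection \<open>The approximants\<close>

definition P_pol ::
    "'a::idom_divide \<Rightarrow> nat \<Rightarrow> nat \<Rightarrow> (nat \<Rightarrow> 'a) \<Rightarrow> nat \<Rightarrow> nat \<Rightarrow> 'a poly" where
  "P_pol x r m \<alpha> n l =
     (S_op n x ^^ r) (monom 1 l * (\<Prod>i=1..m. [:- \<alpha> i, 1:] ^ (r * n)))"

definition P_pol_is ::
    "'a::idom_divide \<Rightarrow> nat \<Rightarrow> nat \<Rightarrow> (nat \<Rightarrow> 'a) \<Rightarrow> nat \<Rightarrow> nat \<Rightarrow> nat \<Rightarrow> nat \<Rightarrow> 'a poly" where
  "P_pol_is x r m \<alpha> n l i s =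
     phi_T (\<alpha> i) x (int s) (divided_difference (P_pol x r m \<alpha> n l))"

end

theory Submission
  imports Defs
begin

text \<open>
  With \<open>\<phi>\<close> the functional of index \<open>(i, s)\<close> and \<open>P = P_pol x r m \<alpha> n l\<close>, the coefficient of
  $z^{-e-1}$ in the remainder is \<open>\<phi>\<close>$(T^e P)$. The factors $j+x+e+1$ in the denominators of
  \<open>\<phi>\<close> cancel against the Pochhammer symbols produced by \<open>S_op\<close> when $e < n$ and $s \le r$, so
  this coefficient is $\sum_j q_j R(j) \alpha_i^j$ up to a constant, where $q_j$ are the
  coefficients of the polynomial to which \<open>S_op\<close> is applied and $R$ is a polynomial of degree
  $rn - s$. That sum is the value at $\alpha_i$ of $R(T\,d/dT)$ applied to a polynomial with a
  zero of order $rn > rn - s$ at $\alpha_i$, so it vanishes.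
\<close>

section \<open>Units and exact division\<close>

lemma div_unit_eq_mult:
  fixes u v a :: "'a::idom_divide"
  assumes "u * v = 1"
  shows "a div u = a * v"
proof -
  have "u \<noteq> 0"
    using assms by auto
  moreover have "a = (a * v) * u"
    using assms by (simp add: ac_simps)
  ultimately show ?thesis
    by (metis nonzero_mult_div_cancel_right)
qed

text \<open>The subfield contains every \<open>of_nat j\<close>, and for positive \<open>j\<close>
  these are nonzero in characteristic 0. Applied to \<open>fact n\<close>, this turns the exact
  division in \<open>S_op\<close> into multiplication by an inverse.\<close>

lemma char_0_subfield_of_nat_unit:
  fixes K :: "'a::comm_ring_1 set"
  assumes "char_0_subfield K" and "k > 0"
  obtains v where "of_nat k * v = (1::'a)"
proof -
  have "of_nat j \<in> K" for j
    using assms(1) by (induction j) (auto simp: char_0_subfield_def)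
  moreover have "of_nat k \<noteq> (0::'a)"
    using assms by (simp add: char_0_subfield_def of_nat_eq_0_iff_char_dvd)
  ultimately show ?thesis
    using assms(1) that unfolding char_0_subfield_def by blast
qed


section \<open>Maps that are diagonal on monomials\<close>

lemma coeff_linear_ext_diagonal:
  "coeff (linear_ext (\<lambda>k. monom (b k) k) P) k = coeff P k * b k"
proof -
  have "coeff (linear_ext (\<lambda>k. monom (b k) k) P) k
      = (\<Sum>j\<le>degree P. if j = k then coeff P k * b k else 0)"
    unfolding linear_ext_def coeff_sum by (intro sum.cong) auto
  also have "\<dots> = coeff P k * b k"
    by (auto simp: coeff_eq_0)
  finally show ?thesis .
qed

lemma coeff_linear_ext_diagonal_funpow:
  "coeff ((linear_ext (\<lambda>k. monom (b k) k) ^^ s) P) k = coeff P k * b k ^ s"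
  by (induction s) (simp_all add: coeff_linear_ext_diagonal ac_simps)

lemma coeff_S_op_funpow:
  "coeff ((S_op n x ^^ r) Q) k
     = coeff Q k * (pochhammer (of_nat k + x + 1) n div of_nat (fact n)) ^ r"
  unfolding S_op_def by (rule coeff_linear_ext_diagonal_funpow)

lemma phi_monom:
  assumes "(of_nat k + x + 1) * v = 1"
  shows "phi \<alpha> x (int s) (monom 1 k) = \<alpha> ^ Suc k * v ^ s"
proof -
  have "(Prim x ^^ s) (monom 1 k) = monom (v ^ s) k"
    unfolding Prim_def
    by (rule poly_eqI)
      (auto simp: coeff_linear_ext_diagonal_funpow div_unit_eq_mult[OF assms])
  then show ?thesis
    by (simp add: phi_def Prim_iter_def poly_monom ac_simps)
qed


section \<open>The divided difference\<close>

text \<open>In (z^j - T^j)/(z - T) the coefficient of T^k is z^(j-k-1) for j > k and 0 otherwise.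
  Hence the coefficient of T^k is \<open>P\<close> with its exponents lowered by k + 1 and its lower
  terms dropped.\<close>

lemma coeff_divided_difference:
  fixes P :: "'a::idom_divide poly"
  shows "coeff (divided_difference P) k = poly_shift (Suc k) P"
proof -
  define D where "D = (\<Sum>k\<le>degree P. monom (poly_shift (Suc k) P) k)"
  have coeff_D: "coeff D k = poly_shift (Suc k) P" for k
  proof -
    have "coeff D k = (\<Sum>j\<le>degree P. if j = k then poly_shift (Suc k) P else 0)"
      by (auto simp: D_def coeff_sum intro!: sum.cong)
    also have "\<dots> = poly_shift (Suc k) P"
      by (auto intro!: poly_eqI simp: coeff_poly_shift coeff_eq_0)
    finally show ?thesis .
  qed
  \<comment> \<open>Multiplication by z is \<open>pCons 0\<close>, so this identity makes the
    product of \<open>D\<close> with z - T telescope.\<close>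
  have shift: "pCons 0 (poly_shift (Suc j) P) = poly_shift j P - [:coeff P j:]" for j
    by (rule poly_eqI) (auto simp: coeff_poly_shift coeff_pCons split: nat.split)
  have "[:P:] - map_poly (\<lambda>c. [:c:]) P = D * [:[:0, 1:], [:- 1:]:]"
  proof (rule poly_eqI)
    fix j
    show "coeff ([:P:] - map_poly (\<lambda>c. [:c:]) P) j = coeff (D * [:[:0, 1:], [:- 1:]:]) j"
      by (cases j) (simp_all add: coeff_D shift coeff_map_poly)
  qed
  then have "divided_difference P = D"
    unfolding divided_difference_def
    by (metis nonzero_mult_div_cancel_right pCons_eq_0_iff zero_neq_one)
  then show ?thesis
    by (simp add: coeff_D)
qed

lemma coeff_phi_T_divided_difference:
  fixes P :: "'a::idom_divide poly"
  assumes "degree P \<le> d"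
  shows "coeff (phi_T \<alpha> x s (divided_difference P)) e
           = (\<Sum>k\<le>d. phi \<alpha> x s (monom 1 k) * coeff P (Suc (k + e)))"
proof -
  let ?D = "divided_difference P"
  have "degree ?D \<le> d"
    using assms
    by (intro degree_le) (auto intro!: poly_eqI simp: coeff_divided_difference
        coeff_poly_shift coeff_eq_0)
  then have "phi_T \<alpha> x s ?D = (\<Sum>k\<le>d. smult (phi \<alpha> x s (monom 1 k)) (coeff ?D k))"
    unfolding phi_T_def by (intro sum.mono_neutral_left) (auto simp: coeff_eq_0)
  then show ?thesis
    by (simp add: coeff_sum coeff_divided_difference coeff_poly_shift ac_simps)
qed


section \<open>Laurent coefficients in 1/z\<close>

lemma poly_as_sum_le:
  fixes P :: "'a::comm_semiring_1 poly"
  shows "degree P \<le> d \<Longrightarrow> poly P a = (\<Sum>k\<le>d. coeff P k * a ^ k)"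
  unfolding poly_altdef by (intro sum.mono_neutral_left) (auto simp: coeff_eq_0)

text \<open>The series variable is 1/z, so multiplying by z^k makes index \<open>i\<close> read off
  index \<open>i + int k\<close> of \<open>f\<close>.\<close>

lemma fls_nth_poly_in_z_mult:
  assumes "degree P \<le> d"
  shows "fls_nth (poly_in_z P * f) i = (\<Sum>k\<le>d. coeff P k * fls_nth f (i + int k))"
proof -
  have "degree (map_poly fls_const P) \<le> d"
    using assms by (intro degree_le) (simp add: coeff_map_poly coeff_eq_0)
  then have "poly_in_z P = (\<Sum>k\<le>d. fls_const (coeff P k) * fls_X_inv ^ k)"
    by (subst poly_in_z_def, subst poly_as_sum_le) (simp_all add: coeff_map_poly)
  then have "poly_in_z P * f = (\<Sum>k\<le>d. fls_const (coeff P k) * (fls_X_inv ^ k * f))"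
    by (simp add: sum_distrib_right mult.assoc)
  then show ?thesis
    by (simp add: fls_nth_sum fls_X_inv_power_times_conv_shift)
qed

lemma fls_nth_poly_in_z:
  "fls_nth (poly_in_z P) i = (if i \<le> 0 then coeff P (nat (- i)) else 0)"
proof -
  have "fls_nth (poly_in_z P) i = (\<Sum>k\<le>degree P. coeff P k * fls_nth 1 (i + int k))"
    using fls_nth_poly_in_z_mult[of P "degree P" 1 i] by simp
  also have "\<dots> = (\<Sum>k\<le>degree P. if k = nat (- i) \<and> i \<le> 0 then coeff P (nat (- i)) else 0)"
    by (intro sum.cong) auto
  also have "\<dots> = (if i \<le> 0 then coeff P (nat (- i)) else 0)"
    by (cases "i \<le> 0") (auto simp: coeff_eq_0)
  finally show ?thesis .
qed

lemma ord_infty_geI: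
  assumes "\<And>i. i < N \<Longrightarrow> fls_nth f i = 0"
  shows "ord_infty f \<ge> Fin N"
  using assms fls_subdegree_geI[of f N] by (auto simp: ord_infty_def)


section \<open>Vanishing sums at a zero of high order\<close>

text \<open>
  Induction on \<open>R\<close>, trading a factor \<open>of_nat j\<close> for the operator $T\,d/dT$ on \<open>Q\<close>, which lowers
  the order of a zero at \<open>a\<close> by at most one.
\<close>

lemma sum_coeff_poly_eq_0:
  fixes Q R :: "'a::idom poly"
  assumes "degree Q \<le> d" and "[:- a, 1:] ^ N dvd Q" and "degree R < N"
  shows "(\<Sum>j\<le>d. coeff Q j * poly R (of_nat j) * a ^ j) = 0"
  using assms
proof (induction R arbitrary: Q N)
  case 0
  then show ?case by simp
next
  case (pCons c R)
  obtain N' where N: "N = Suc N'"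
    using pCons.prems(3) by (cases N) auto
  define Q' where "Q' = pCons 0 (pderiv Q)"
  have coeff_Q': "coeff Q' j = of_nat j * coeff Q j" for j
    by (cases j) (simp_all add: Q'_def coeff_pderiv)
  have "[:- a, 1:] dvd Q"
    using pCons.prems(2) dvd_trans[OF dvd_power[of N "[:- a, 1:]"]] N by simp
  then have "(\<Sum>j\<le>d. coeff Q j * a ^ j) = 0"
    using pCons.prems(1) by (simp add: poly_as_sum_le[symmetric] poly_eq_0_iff_dvd)
  moreover have "(\<Sum>j\<le>d. coeff Q' j * poly R (of_nat j) * a ^ j) = 0"
  \<comment> \<open>For \<open>R = 0\<close> the degree of \<open>pCons c R\<close> is 0 and
    \<open>N'\<close> may be 0, so \<open>degree R < N'\<close> can fail; the sum is then trivially
    0.\<close>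
  proof (cases "R = 0")
    case False
    have "degree Q' \<le> d"
      using pCons.prems(1) by (intro degree_le) (auto simp: coeff_Q' coeff_eq_0)
    moreover have "[:- a, 1:] ^ N' dvd Q'"
    proof -
      obtain H where H: "Q = [:- a, 1:] ^ Suc N' * H"
        using pCons.prems(2) N by auto
      have "pderiv Q = [:- a, 1:] ^ N' *
          ([:- a, 1:] * pderiv H + smult (of_nat (Suc N')) H)"
        unfolding H pderiv_mult pderiv_power_Suc
        by (simp add: pderiv_pCons algebra_simps one_pCons[symmetric]
            del: mult_pCons_left mult_pCons_right of_nat_Suc)
      then have "[:- a, 1:] ^ N' dvd [:0, 1:] * pderiv Q"
        by (metis dvd_mult dvd_triv_left)
      then show ?thesis
        by (simp add: Q'_def)
    qed
    moreover have "degree R < N'"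
      using pCons.prems(3) False N by simp
    ultimately show ?thesis
      by (rule pCons.IH)
  qed simp
  moreover have "(\<Sum>j\<le>d. coeff Q j * poly (pCons c R) (of_nat j) * a ^ j)
      = c * (\<Sum>j\<le>d. coeff Q j * a ^ j) + (\<Sum>j\<le>d. coeff Q' j * poly R (of_nat j) * a ^ j)"
    by (simp add: coeff_Q' sum_distrib_left sum.distrib[symmetric] algebra_simps)
  ultimately show ?case
    by simp
qed

text \<open>The Pochhammer symbol is the product of the j + x + 1 + h over h < n, and
  \<open>w (e + j)\<close> inverts the factor with h = e. As s \<le> r, each of the s inverses
  cancels against a different copy of the symbol.\<close>

lemma pochhammer_div_powers_poly:
  fixes x v :: "'a::idom_divide" and w :: "nat \<Rightarrow> 'a"
  assumes v: "of_nat (fact n) * v = 1"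
    and w: "\<And>k. (of_nat k + x + 1) * w k = 1"
    and "e < n" and s: "1 \<le> s" "s \<le> r"
  obtains R where "degree R < r * n"
    and "\<And>j. (pochhammer (of_nat j + x + 1) n div of_nat (fact n)) ^ r * w (e + j) ^ s
           = poly R (of_nat j)"
proof -
  define F where "F = (\<lambda>A. \<Prod>h\<in>A. [:x + 1 + of_nat h, 1:])"
  \<comment> \<open>The s copies that lose their factor are followed by the r - s intact ones;
    \<open>v ^ r\<close> collects the inverse factorials.\<close>
  define R where "R = smult (v ^ r) (F ({..<n} - {e}) ^ s * F {..<n} ^ (r - s))"
  have degree_F: "degree (F A) \<le> card A" if "finite A" for A
    using degree_prod_sum_le[OF that, of "\<lambda>h. [:x + 1 + of_nat h, 1:]"] by (simp add: F_def)
  have "degree (F ({..<n} - {e})) \<le> n - 1" "degree (F {..<n}) \<le> n"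
    using degree_F[of "{..<n} - {e}"] degree_F[of "{..<n}"] \<open>e < n\<close> by simp_all
  then have "degree R \<le> (n - 1) * s + n * (r - s)"
    unfolding R_def
    by (meson add_mono degree_mult_le degree_power_le degree_smult_le mult_le_mono1 order_trans)
  also have "\<dots> < n * s + n * (r - s)"
    using \<open>e < n\<close> s by simp
  also have "\<dots> = r * n"
    using s by (simp flip: distrib_left)
  finally have "degree R < r * n" .
  moreover have "(pochhammer (of_nat j + x + 1) n div of_nat (fact n)) ^ r * w (e + j) ^ s
      = poly R (of_nat j)" for j
  proof -
    let ?u = "of_nat (e + j) + x + 1" and ?W = "poly (F ({..<n} - {e})) (of_nat j)"
    let ?p = "pochhammer (of_nat j + x + 1) n"
    have "?p = poly (F {..<n}) (of_nat j)"
      by (simp add: F_def poly_prod pochhammer_prod atLeast0LessThan ac_simps)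
    moreover have "poly (F {..<n}) (of_nat j) = ?u * ?W"
      using \<open>e < n\<close> by (simp add: F_def prod.remove[of "{..<n}" e] algebra_simps)
    ultimately have p: "?p = poly (F {..<n}) (of_nat j)" "?p * w (e + j) = ?W"
      using w[of "e + j"] by (simp_all add: ac_simps)
    have "(?p * v) ^ r * w (e + j) ^ s = v ^ r * ((?p * w (e + j)) ^ s * ?p ^ (r - s))"
      using s by (simp add: power_mult_distrib ac_simps flip: power_add)
    also have "\<dots> = poly R (of_nat j)"
      unfolding p(2) by (simp add: R_def p(1))
    finally show ?thesis
      by (simp add: div_unit_eq_mult[OF v])
  qed
  ultimately show ?thesis
    using that by blast
qed

section \<open>The approximants\<close>

lemma degree_P_pol_le: "degree (P_pol x r m \<alpha> n l) \<le> r * m * n + l"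
proof -
  let ?Q = "monom 1 l * (\<Prod>i=1..m. [:- \<alpha> i, 1:] ^ (r * n))"
  have "degree (\<Prod>i=1..m. [:- \<alpha> i, 1:] ^ (r * n)) \<le> (\<Sum>i=1..m. r * n)"
    by (rule order_trans[OF degree_prod_sum_le]) (auto intro!: sum_mono simp: degree_power_eq)
  then have "degree ?Q \<le> r * m * n + l"
    by (intro order_trans[OF degree_mult_le]) (simp add: degree_monom_eq ac_simps)
  then show ?thesis
    unfolding P_pol_def by (intro degree_le) (simp add: coeff_S_op_funpow coeff_eq_0)
qed

theorem theorem2:
  fixes K :: "'a :: {factorial_semiring, idom_divide} set"
    and x :: 'a and \<alpha> :: "nat \<Rightarrow> 'a" and r m n l :: nat
  assumes "char_0_subfield K"
    and "x \<notin> of_int ` {k. k < 0}"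
    and "\<forall>k::nat. k > 0 \<longrightarrow> (x + of_nat k) dvd 1"
    and "r > 0" and "m > 0"
    and "\<forall>i\<in>{1..m}. \<alpha> i \<noteq> 0" and "inj_on \<alpha> {1..m}"
    and "n > 0" and "l \<le> r * m"
  shows "pade_type_approximant ({1..m} \<times> {1..r})
           (\<lambda>(i, s). Phi s x (\<alpha> i)) (\<lambda>_. n) (r * m * n + l)
           (P_pol x r m \<alpha> n l) (\<lambda>(i, s). P_pol_is x r m \<alpha> n l i s)"
proof -
  let ?P = "P_pol x r m \<alpha> n l" and ?d = "r * m * n + l"
  define Q where "Q = monom 1 l * (\<Prod>i=1..m. [:- \<alpha> i, 1:] ^ (r * n))"
  obtain v :: 'a where v: "of_nat (fact n) * v = 1"
    using char_0_subfield_of_nat_unit[OF assms(1), of "fact n"] by auto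
  have "\<exists>w. (of_nat k + x + 1) * w = 1" for k
    using assms(3)[rule_format, of "Suc k"] by (auto simp: ac_simps elim!: dvdE)
  then obtain w where w: "\<And>k. (of_nat k + x + 1) * w k = 1"
    by metis
  have "Fin (int n + 1) \<le> ord_infty (poly_in_z ?P * Phi s x (\<alpha> i)
          - poly_in_z (P_pol_is x r m \<alpha> n l i s))"
    if i: "i \<in> {1..m}" and s: "s \<in> {1..r}" for i s
  proof (rule ord_infty_geI)
    fix k :: int
    assume k: "k < int n + 1"
    define g where "g = (\<lambda>j. \<alpha> i ^ Suc j * w j ^ s)"
    have "w j ^ s * (of_nat j + x + 1) ^ s = 1" for j
      using w[of j] by (simp flip: power_mult_distrib add: mult.commute)
    then have "\<alpha> i ^ (j + 1) div (of_nat j + x + 1) ^ s = g j" for j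
      unfolding g_def by (subst div_unit_eq_mult[where v = "w j ^ s"]) (simp_all add: mult.commute)
    then have Phi_nth: "fls_nth (Phi s x (\<alpha> i)) h = (if h \<ge> 1 then g (nat (h - 1)) else 0)" for h
      by (simp add: Phi_def fls_X_times_conv_shift)
    have phi_g: "phi (\<alpha> i) x (int s) (monom 1 j) = g j" for j
      using phi_monom[OF w] by (simp add: g_def)
    have nth: "fls_nth (poly_in_z ?P * Phi s x (\<alpha> i)) k
        = (\<Sum>j\<le>?d. coeff ?P j * fls_nth (Phi s x (\<alpha> i)) (k + int j))"
      by (rule fls_nth_poly_in_z_mult[OF degree_P_pol_le])
    show "fls_nth (poly_in_z ?P * Phi s x (\<alpha> i) - poly_in_z (P_pol_is x r m \<alpha> n l i s)) k = 0"
    \<comment> \<open>Indices k \<le> 0 are the polynomial part, which \<open>P_pol_is\<close>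
      cancels exactly. For 1 \<le> k \<le> n the coefficient of the product itself must
      vanish.\<close>
    proof (cases "k \<le> 0")
      case True
      define e where "e = nat (- k)"
      have k_eq: "k = - int e"
        using True by (simp add: e_def)
      \<comment> \<open>The series starts at index 1, so only j \<ge> e + 1 contributes; shifting j
        by e + 1 then gives the coefficient of the divided difference under
        \<open>phi_T\<close>.\<close>
      have "(\<Sum>j\<le>?d. coeff ?P j * fls_nth (Phi s x (\<alpha> i)) (k + int j))
          = (\<Sum>j\<in>{Suc e..?d}. coeff ?P j * g (j - Suc e))"
        by (intro sum.mono_neutral_cong_right)
          (auto simp: Phi_nth k_eq nat_diff_distrib intro!: arg_cong[where f = g])
      also have "\<dots> = (\<Sum>j\<in>{..?d} \<inter> {j. Suc (j + e) \<le> ?d}. g j * coeff ?P (Suc (j + e)))"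
        by (rule sum.reindex_bij_witness[of _ "\<lambda>j. Suc (j + e)" "\<lambda>j. j - Suc e"]) auto
      also have "\<dots> = (\<Sum>j\<le>?d. g j * coeff ?P (Suc (j + e)))"
        using degree_P_pol_le[of x r m \<alpha> n l]
        by (intro sum.mono_neutral_left) (auto intro!: coeff_eq_0)
      also have "\<dots> = coeff (P_pol_is x r m \<alpha> n l i s) e"
        by (simp add: P_pol_is_def coeff_phi_T_divided_difference[OF degree_P_pol_le] phi_g)
      finally show ?thesis
        using True by (simp add: nth fls_nth_poly_in_z e_def)
    next
      case False
      define e where "e = nat (k - 1)"
      have k_eq: "k = int e + 1" and "e < n"
        using False k by (auto simp: e_def)
      obtain R where R: "degree R < r * n"
        "\<And>j. (pochhammer (of_nat j + x + 1) n div of_nat (fact n)) ^ r * w (e + j) ^ s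
           = poly R (of_nat j)"
        using pochhammer_div_powers_poly[of n v x w e s r] v w \<open>e < n\<close> s by auto
      have "[:- \<alpha> i, 1:] ^ (r * n) dvd Q"
        unfolding Q_def using i by (intro dvd_mult dvd_prodI) auto
      \<comment> \<open>The maximum gives one summation range for both \<open>Q\<close> and
        \<open>?P\<close>, whose coefficients are compared term by term below.\<close>
      moreover have "degree Q \<le> max (degree Q) ?d"
        by simp
      ultimately have sum_0:
        "(\<Sum>j\<le>max (degree Q) ?d. coeff Q j * poly R (of_nat j) * \<alpha> i ^ j) = 0"
        using R(1) sum_coeff_poly_eq_0 by blast
      have "fls_nth (poly_in_z ?P * Phi s x (\<alpha> i)) k
          = (\<Sum>j\<le>max (degree Q) ?d. coeff ?P j * fls_nth (Phi s x (\<alpha> i)) (k + int j))"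
        by (rule fls_nth_poly_in_z_mult) (meson degree_P_pol_le max.cobounded2 order_trans)
      also have "\<dots> = (\<Sum>j\<le>max (degree Q) ?d. coeff ?P j * g (e + j))"
        by (intro sum.cong) (auto simp: Phi_nth k_eq nat_add_distrib)
      \<comment> \<open>\<open>S_op\<close> contributes the Pochhammer quotient to the power r and
        \<open>g\<close> the inverse powers, which combine to R(j); the constant \<alpha>_i^(e+1)
        splits off.\<close>
      also have "\<dots> = (\<Sum>j\<le>max (degree Q) ?d.
          \<alpha> i ^ Suc e * (coeff Q j * poly R (of_nat j) * \<alpha> i ^ j))"
        by (simp add: P_pol_def coeff_S_op_funpow g_def Q_def power_add ac_simps flip: R(2))
      also have "\<dots> = 0"
        by (simp only: sum_distrib_left[symmetric] sum_0 mult_zero_right)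
      finally show ?thesis
        using False by (simp add: fls_nth_poly_in_z)
    qed
  qed
  moreover have "Phi s x (\<alpha> i) \<in> inv_z_series" for i s
    by (simp add: Phi_def inv_z_series_def)
  moreover have "r * m * n + l \<ge> 1"
    using assms(4,5,8) by (simp add: Suc_le_eq)
  ultimately show ?thesis
    unfolding pade_type_approximant_def by (auto simp: degree_P_pol_le)
qed

end
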